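(* For all integers $n\ge 0$ and $c\ge 2$, and any two distinct colors $a\neq b$ in $\{1,\dots,c\}$, $$\left|\Pi_n^{eq}\wr C_c(1^a1^a)\right|=\left|\Pi_n^{eq}\wr C_c(1^a1^b)\right|.$$
   Context: $\Pi_n\wr C_c$ denotes the set of colored set partitions of $[n]$: pairs consisting of a set partition of $[n]$ (a collection of disjoint nonempty blocks with union $[n]$) and an assignment of a color in $\{1,\dots,c\}$ to each element. A colored partition eq-contains $1^a1^a$ if some block contains two elements $x<y$ both colored $a$; it eq-contains $1^a1^b$ if some block contains elements $x<y$ with $x$ colored $a$ and $y$ colored $b$. $\Pi_n^{eq}\wr C_c(P)$ is the set of elements of $\Pi_n\wr C_c$ that do not eq-contain $P$. *)

theory Defs
  imports "HOL-Library.Disjoint_Sets" "HOL-Library.FuncSet"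
begin

text \<open>
  A coloring is an extensional function on \<open>{1..n}\<close> (it is \<open>undefined\<close> elsewhere), so that distinct
  members of this set are distinct colored partitions and \<open>card\<close> counts them correctly.
\<close>
definition colored_partitions :: "nat \<Rightarrow> nat \<Rightarrow> (nat set set \<times> (nat \<Rightarrow> nat)) set" where
  "colored_partitions n c = {(P, f). partition_on {1..n} P \<and> f \<in> {1..n} \<rightarrow>\<^sub>E {1..c}}"

text \<open>Eq-containment of the pattern \<open>1\<^sup>a1\<^sup>b\<close>; the pattern \<open>1\<^sup>a1\<^sup>a\<close> is the case \<open>b = a\<close>.\<close>
definition eq_contains :: "nat set set \<times> (nat \<Rightarrow> nat) \<Rightarrow> nat \<Rightarrow> nat \<Rightarrow> bool" where
  "eq_contains \<pi> a b \<longleftrightarrow>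
     (\<exists>B \<in> fst \<pi>. \<exists>x \<in> B. \<exists>y \<in> B. x < y \<and> snd \<pi> x = a \<and> snd \<pi> y = b)"

definition eq_avoiders :: "nat \<Rightarrow> nat \<Rightarrow> nat \<Rightarrow> nat \<Rightarrow> (nat set set \<times> (nat \<Rightarrow> nat)) set" where
  "eq_avoiders n c a b = {\<pi> \<in> colored_partitions n c. \<not> eq_contains \<pi> a b}"

lemma finite_colored_partitions: "finite (colored_partitions n c)"
proof (rule finite_subset)
  show "colored_partitions n c \<subseteq> Pow (Pow {1..n}) \<times> ({1..n} \<rightarrow>\<^sub>E {1..c})"
    by (auto simp: colored_partitions_def partition_on_def)
  show "finite (Pow (Pow {1..n}) \<times> ({1..n} \<rightarrow>\<^sub>E {1..c}))"
    by (intro finite_cartesian_product finite_PiE) auto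
qed

lemma finite_eq_avoiders: "finite (eq_avoiders n c a b)"
  unfolding eq_avoiders_def using finite_colored_partitions by simp

end

theory Submission
  imports Defs
begin

text \<open>
  Call \<open>x\<close> preceded if a smaller element of its block has color \<open>a\<close>. A colored partition avoids
  \<open>1\<^sup>a1\<^sup>v\<close> iff no preceded element has color \<open>v\<close>. Changing the color of the preceded elements from
  \<open>u\<close> to \<open>v\<close> does not affect the first \<open>a\<close> of any block, hence not the preceded elements, so it is
  a bijection from the avoiders of \<open>1\<^sup>a1\<^sup>v\<close> to those of \<open>1\<^sup>a1\<^sup>u\<close>, undone by changing \<open>v\<close> back to \<open>u\<close>.
\<close>

definition preceded :: "nat \<Rightarrow> nat set set \<Rightarrow> (nat \<Rightarrow> nat) \<Rightarrow> nat \<Rightarrow> bool" where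
  "preceded a P f x \<longleftrightarrow> (\<exists>B\<in>P. x \<in> B \<and> (\<exists>y\<in>B. y < x \<and> f y = a))"

definition recolor ::
  "nat \<Rightarrow> nat \<Rightarrow> nat \<Rightarrow> nat set set \<times> (nat \<Rightarrow> nat) \<Rightarrow> nat set set \<times> (nat \<Rightarrow> nat)" where
  "recolor a u v \<pi> =
     (fst \<pi>, \<lambda>x. if snd \<pi> x = u \<and> preceded a (fst \<pi>) (snd \<pi>) x then v else snd \<pi> x)"

lemma eq_contains_iff_preceded:
  "eq_contains \<pi> a v \<longleftrightarrow> (\<exists>x. preceded a (fst \<pi>) (snd \<pi>) x \<and> snd \<pi> x = v)"
  unfolding eq_contains_def preceded_def by blast

text \<open>Recoloring can create an \<open>a\<close> (if \<open>v = a\<close>) or destroy one (if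
  \<open>u = a\<close>), but only at preceded elements, and these come after the first
  \<open>a\<close> of their block, which stays.\<close>

lemma preceded_recolor:
  assumes P: "partition_on A P"
  shows "preceded a P (snd (recolor a u v (P, f))) x \<longleftrightarrow> preceded a P f x"
proof
  have same_block: "B = C" if "B \<in> P" "C \<in> P" "y \<in> B" "y \<in> C" for B C y
    using P that by (auto simp: partition_on_def disjoint_def)
  show "preceded a P f x" if pre: "preceded a P (snd (recolor a u v (P, f))) x"
  proof -
    from pre obtain B y where B: "B \<in> P" "x \<in> B" "y \<in> B" "y < x"
      and y: "snd (recolor a u v (P, f)) y = a"
      unfolding preceded_def by blast
    show ?thesis
    proof (cases "f y = a")
      case True
      with B show ?thesis unfolding preceded_def by blast
    next
      case False
      \<comment> \<open>\<open>y\<close> got color \<open>a\<close> only by recoloring, so it is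
        preceded; an original \<open>a\<close> before \<open>y\<close> is also before
        \<open>x\<close>.\<close>
      with y have "preceded a P f y" by (auto simp: recolor_def split: if_splits)
      then obtain C z where C: "C \<in> P" "y \<in> C" "z \<in> C" "z < y" "f z = a"
        unfolding preceded_def by blast
      with B have "z \<in> B" "z < x" using same_block by auto
      with B C show ?thesis unfolding preceded_def by blast
    qed
  qed
  show "preceded a P (snd (recolor a u v (P, f))) x" if pre: "preceded a P f x"
  proof -
    from pre obtain B y where B: "B \<in> P" "x \<in> B" and y: "y \<in> B \<and> y < x \<and> f y = a"
      unfolding preceded_def by blast
    \<comment> \<open>The given \<open>y\<close> may lose color \<open>a\<close> when
      \<open>u = a\<close>; the first \<open>a\<close> of the block is not preceded and keeps
      it.\<close>
    define m where "m = (LEAST y. y \<in> B \<and> y < x \<and> f y = a)"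
    have m: "m \<in> B" "m < x" "f m = a"
      using LeastI[of "\<lambda>y. y \<in> B \<and> y < x \<and> f y = a", OF y] by (auto simp: m_def)
    have "\<not> preceded a P f m"
    proof
      assume "preceded a P f m"
      then obtain C z where "C \<in> P" "m \<in> C" "z \<in> C" "z < m" "f z = a"
        unfolding preceded_def by blast
      moreover from this have "z \<in> B" using same_block B m by blast
      ultimately show False
        using m not_less_Least[of z "\<lambda>y. y \<in> B \<and> y < x \<and> f y = a"] by (auto simp: m_def)
    qed
    with m have "snd (recolor a u v (P, f)) m = a" by (simp add: recolor_def)
    with B m show ?thesis unfolding preceded_def by blast
  qed
qed

lemma recolor_in_eq_avoiders:
  assumes \<pi>: "\<pi> \<in> eq_avoiders n c a v" and v: "v \<in> {1..c}" and "u \<noteq> v"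
  shows "recolor a u v \<pi> \<in> eq_avoiders n c a u"
proof -
  obtain P f where Pf: "\<pi> = (P, f)" by (cases \<pi>)
  have P: "partition_on {1..n} P" and f: "f \<in> {1..n} \<rightarrow>\<^sub>E {1..c}"
    using \<pi> by (auto simp: Pf eq_avoiders_def colored_partitions_def)
  \<comment> \<open>Since \<open>undefined\<close> may equal \<open>u\<close>, this is what keeps
    the new coloring extensional.\<close>
  have "\<not> preceded a P f x" if "x \<notin> {1..n}" for x
    using P that by (auto simp: preceded_def partition_on_def)
  then have "snd (recolor a u v (P, f)) \<in> {1..n} \<rightarrow>\<^sub>E {1..c}"
    using f v by (auto simp: recolor_def PiE_iff extensional_def)
  \<comment> \<open>Preceded elements of color \<open>u\<close> were all changed to
    \<open>v\<close>, and no element acquires color \<open>u\<close>.\<close>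
  moreover have "\<not> eq_contains (recolor a u v (P, f)) a u"
    using \<open>u \<noteq> v\<close> preceded_recolor[OF P, of a u v f]
    by (auto simp: eq_contains_iff_preceded) (auto simp: recolor_def split: if_splits)
  ultimately show ?thesis
    using P by (simp add: Pf eq_avoiders_def colored_partitions_def recolor_def)
qed

text \<open>By avoidance no preceded element has color \<open>v\<close> at first, so the preceded
  elements colored \<open>v\<close> afterwards are exactly those that were \<open>u\<close>.\<close>

lemma recolor_recolor:
  assumes \<pi>: "\<pi> \<in> eq_avoiders n c a v"
  shows "recolor a v u (recolor a u v \<pi>) = \<pi>"
proof -
  obtain P f where Pf: "\<pi> = (P, f)" by (cases \<pi>)
  have P: "partition_on {1..n} P" and av: "\<And>x. preceded a P f x \<Longrightarrow> f x \<noteq> v"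
    using \<pi> by (auto simp: Pf eq_avoiders_def colored_partitions_def eq_contains_iff_preceded)
  have "recolor a v u (recolor a u v (P, f)) =
    (P, \<lambda>x. if snd (recolor a u v (P, f)) x = v \<and> preceded a P f x then u
            else snd (recolor a u v (P, f)) x)"
    using preceded_recolor[OF P, of a u v f] by (simp add: recolor_def fun_eq_iff)
  also have "\<dots> = (P, f)"
    using av by (auto simp: recolor_def fun_eq_iff)
  finally show ?thesis by (simp add: Pf)
qed

lemma bij_betw_recolor:
  assumes "u \<in> {1..c}" "v \<in> {1..c}" "u \<noteq> v"
  shows "bij_betw (recolor a u v) (eq_avoiders n c a v) (eq_avoiders n c a u)"
proof (rule bij_betw_byWitness[where f' = "recolor a v u"])
  show "recolor a u v ` eq_avoiders n c a v \<subseteq> eq_avoiders n c a u"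
    using recolor_in_eq_avoiders[OF _ assms(2,3)] by blast
  show "recolor a v u ` eq_avoiders n c a u \<subseteq> eq_avoiders n c a v"
    using recolor_in_eq_avoiders[OF _ assms(1) assms(3)[symmetric]] by blast
qed (auto simp: recolor_recolor)

theorem theorem2p2:
  fixes n c a b :: nat
  assumes "c \<ge> 2"
    and "a \<in> {1..c}" and "b \<in> {1..c}" and "a \<noteq> b"
  shows "card (eq_avoiders n c a a) = card (eq_avoiders n c a b)"
  \<comment> \<open>The case \<open>u = b\<close>, \<open>v = a\<close> of the bijection.\<close>
  using bij_betw_same_card[OF bij_betw_recolor] assms by metis

end
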